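(* Let $N\ge2$, $k\ge1$, let $\mu,\nu\in P_k^+$ be arbitrary weights of level $k$, let $0\le t\le N-1$ and $0\le m\le k$, let $\lambda\in P_k^+$ be the weight associated to the orbit $[m\lambda_1]\times[k\lambda_1]^t$, and write the standard form of $[\mu]$ as $\hat\mu=((N-1)^{a_{N-1}},\dots,1^{a_1},0^{a_0})$. For $0\le i\le N-1$ set $b_i=a_{i-t}$ if $i\ge t$ and $b_i=a_{N-(t-i)}$ if $i<t$. Then $M_{[\lambda],[\mu]}^{(k)[\nu]}=1$ if there exist integers $m_0,\dots,m_{N-1}$ with $\sum_{i=0}^{N-1}m_i=m$ and $0\le m_i\le b_i$ for all $i$ such that the standard form of $[\nu]$ is $$\hat\nu=\left((N-1)^{b_{N-1}-m_{N-1}+m_{N-2}},\dots,1^{b_1-m_1+m_0},0^{b_0-m_0+m_{N-1}}\right),$$ and $M_{[\lambda],[\mu]}^{(k)[\nu]}=0$ otherwise.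
   Context: Weights: $\lambda_1,\dots,\lambda_{N-1}$ are the fundamental weights of $sl_N$, and the weights of level $k$ are $P_k^+=\{\sum_{j=1}^{N-1}a_j\lambda_j : a_j\in\mathbb{Z}_{\ge 0},\ \sum_{j=1}^{N-1} a_j\le k\}$. Orbits: $S_k$ acts on $\mathbb{Z}_N^k$ (where $\mathbb{Z}_N=\mathbb{Z}/N\mathbb{Z}$) by permuting coordinates; $[x]$ is the orbit of $x$, and $\mathcal{O}(N,k)$ is the set of orbits. A weight $\lambda=\sum_{j=1}^{N-1} a_j\lambda_j\in P_k^+$ corresponds to the orbit $[\lambda]$ whose (unique) representative in standard form is $\hat\lambda=((N-1)^{a_{N-1}},\dots,1^{a_1},0^{a_0})$, $a_0=k-\sum_{j\ge1}a_j$, where exponents denote numbers of repetitions. This is a bijection between $P_k^+$ and $\mathcal{O}(N,k)$. For orbits $[a],[b],[c]$ let $T([a],[b],[c])=\{(x,y,z)\in[a]\times[b]\times[c] : x+y=z\}$, with $S_k$ acting by $\sigma(x,y,z)=(\sigma x,\sigma y,\sigma z)$; $M_{[a],[b]}^{(k)[c]}$ is the number of $S_k$-orbits of $T([a],[b],[c])$. The orbit product is $[a]\times[b]=\sum_{[c]}M_{[a],[b]}^{(k)[c]}[c]$, extended bilinearly. One has $[k\lambda_1]=[(1^k)]$, $[k\lambda_1]^t=[(t^k)]$ for $0\le t\le N-1$ (with $[k\lambda_1]^0=[(0^k)]$), and $[m\lambda_1]\times[k\lambda_1]^t$ is a single orbit. *)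

theory Defs
  imports
    "HOL-Number_Theory.Residues"
    "HOL-Combinatorics.Permutations"
    "HOL-Library.Poly_Mapping"
begin

(* Weights of sl_N are written in the basis of fundamental weights: a dominant weight is the
   function sending j to the coefficient of lambda_j, and it is 0 outside 1, ..., N - 1. *)

type_synonym weight = "nat \<Rightarrow> nat"

definition fund_weight :: "nat \<Rightarrow> weight" where
  "fund_weight j = (\<lambda>i. if i = j then 1 else 0)"

definition wmult :: "nat \<Rightarrow> weight \<Rightarrow> weight" where
  "wmult c v = (\<lambda>i. c * v i)"

definition level_weights :: "nat \<Rightarrow> nat \<Rightarrow> weight set" where
  "level_weights N k =
     {(\<lambda>i. \<Sum>j = 1..N - 1. a j * fund_weight j i) | a :: nat \<Rightarrow> nat. (\<Sum>j = 1..N - 1. a j) \<le> k}"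

(* Z_N^k: lists of length k over the ring of residues 0, ..., N - 1. *)

definition zvecs :: "nat \<Rightarrow> nat \<Rightarrow> int list set" where
  "zvecs N k = {x. length x = k \<and> set x \<subseteq> carrier (residue_ring (int N))}"

definition vadd :: "nat \<Rightarrow> int list \<Rightarrow> int list \<Rightarrow> int list" where
  "vadd N x y = map2 (add (residue_ring (int N))) x y"

(* permute_list is an action of the symmetric group from the right; its orbits are those of the
   left action by inverse permutations. *)

definition orb :: "nat \<Rightarrow> int list \<Rightarrow> int list set" where
  "orb k x = {permute_list \<sigma> x | \<sigma>. \<sigma> permutes {..<k}}"

definition orbits :: "nat \<Rightarrow> nat \<Rightarrow> int list set set" where
  "orbits N k = orb k ` zvecs N k"

(* std_form N a is ((N-1)^{a (N-1)}, ..., 1^{a 1}, 0^{a 0}), exponents denoting repetitions. *)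

definition std_form :: "nat \<Rightarrow> (nat \<Rightarrow> nat) \<Rightarrow> int list" where
  "std_form N a = concat (map (\<lambda>i. replicate (a i) (int i)) (rev [0..<N]))"

definition weight_std :: "nat \<Rightarrow> nat \<Rightarrow> weight \<Rightarrow> int list" where
  "weight_std N k v = std_form N (\<lambda>i. if i = 0 then k - (\<Sum>j = 1..N - 1. v j) else v i)"

definition weight_orbit :: "nat \<Rightarrow> nat \<Rightarrow> weight \<Rightarrow> int list set" where
  "weight_orbit N k v = orb k (weight_std N k v)"

definition triples ::
  "nat \<Rightarrow> int list set \<Rightarrow> int list set \<Rightarrow> int list set \<Rightarrow> (int list \<times> int list \<times> int list) set" where
  "triples N A B C = {(x, y, z). x \<in> A \<and> y \<in> B \<and> z \<in> C \<and> vadd N x y = z}"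

definition triple_orb ::
  "nat \<Rightarrow> int list \<times> int list \<times> int list \<Rightarrow> (int list \<times> int list \<times> int list) set" where
  "triple_orb k = (\<lambda>(x, y, z).
     {(permute_list \<sigma> x, permute_list \<sigma> y, permute_list \<sigma> z) | \<sigma>. \<sigma> permutes {..<k}})"

definition orbit_coeff ::
  "nat \<Rightarrow> nat \<Rightarrow> int list set \<Rightarrow> int list set \<Rightarrow> int list set \<Rightarrow> nat" where
  "orbit_coeff N k A B C = card (triple_orb k ` triples N A B C)"

(* Formal integer combinations of orbits are elements of the free abelian group on orbits;
   frag_of is the inclusion of generators and frag_extend is linear extension. *)

definition orbit_prod ::
  "nat \<Rightarrow> nat \<Rightarrow> (int list set \<Rightarrow>\<^sub>0 int) \<Rightarrow> (int list set \<Rightarrow>\<^sub>0 int) \<Rightarrow> (int list set \<Rightarrow>\<^sub>0 int)" where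
  "orbit_prod N k X Y =
     frag_extend (\<lambda>A. frag_extend (\<lambda>B.
       \<Sum>C\<in>orbits N k. frag_cmul (int (orbit_coeff N k A B C)) (frag_of C)) Y) X"

primrec orbit_power ::
  "nat \<Rightarrow> nat \<Rightarrow> (int list set \<Rightarrow>\<^sub>0 int) \<Rightarrow> nat \<Rightarrow> (int list set \<Rightarrow>\<^sub>0 int)" where
  "orbit_power N k X 0 = frag_of (orb k (replicate k 0))"
| "orbit_power N k X (Suc t) = orbit_prod N k (orbit_power N k X t) X"

end

theory Submission
  imports Defs
begin

text \<open>
  The orbit of a vector is determined by the multiset of its entries, and the orbit of a
  triple \<open>(x, y, x + y)\<close> by the multiset of the pairs \<open>(x\<^sub>i, y\<^sub>i)\<close>. So the structure constant
  \<open>M\<close> of the orbit product counts the multisets of pairs whose two marginals are the entries of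
  the factors and whose multiset of sums is the multiset of entries of the product
  (\<open>orbit_coeff_eq_card_gluings\<close>).

  If one factor is constant, such a multiset of pairs is forced, and multiplication by
  \<open>[(c^k)]\<close> just adds \<open>c\<close> to every entry. Hence the orbit of \<open>\<lambda>\<close> has the entry \<open>t + 1\<close> with
  multiplicity \<open>m\<close> and the entry \<open>t\<close> with multiplicity \<open>k - m\<close>. As these two residues differ,
  gluing it to \<open>\<mu>\<close> means choosing the submultiset \<open>P\<close> of size \<open>m\<close> of the entries of \<open>\<mu>\<close> that
  are paired with \<open>t + 1\<close> (\<open>card_gluings_two_values\<close>). Adding \<open>t\<close> to all entries first turns the
  multiplicities of \<open>\<mu>\<close> into \<open>b\<^sub>0, \<dots>, b\<^bsub>N-1\<^esub>\<close>; then \<open>m\<^sub>i\<close> of the \<open>b\<^sub>i\<close> entries equal to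
  \<open>i\<close> are raised by one, which gives the multiplicities \<open>b\<^sub>i - m\<^sub>i + m\<^bsub>i-1\<^esub>\<close>, indices
  being cyclic.

  The target therefore determines all the differences \<open>m\<^sub>i - m\<^bsub>i-1\<^esub>\<close>, that is, the \<open>m\<^sub>i\<close> up
  to a common additive constant, and the condition \<open>\<Sum> m\<^sub>i = m\<close> fixes this constant
  (\<open>int_eq_of_cyclic_differences_eq\<close>). So there is at most one choice, and the structure constant
  is 1 or 0.
\<close>

section \<open>Structure constants as numbers of gluings\<close>

abbreviation add_mod :: "nat \<Rightarrow> int \<Rightarrow> int \<Rightarrow> int" where
  "add_mod N u v \<equiv> (u + v) mod int N"

lemma vadd_conv_map_zip: "vadd N x y = map (\<lambda>(u, v). add_mod N u v) (zip x y)"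
  by (simp add: vadd_def residue_ring_def)

lemma orb_eq_mset_class:
  assumes "length x = k"
  shows "orb k x = {y. mset y = mset x}"
proof (intro equalityI subsetI)
  fix y assume "y \<in> {y. mset y = mset x}"
  then obtain \<sigma> where "\<sigma> permutes {..<length x}" "permute_list \<sigma> x = y"
    using mset_eq_permutation[of y x] by auto
  then show "y \<in> orb k x" using assms by (auto simp: orb_def)
qed (use assms in \<open>auto simp: orb_def\<close>)

lemma orb_eq_iff:
  assumes "length x = k" "length y = k"
  shows "orb k x = orb k y \<longleftrightarrow> mset x = mset y"
  using assms by (auto simp: orb_eq_mset_class)

text \<open>
  Permuting two vectors simultaneously is the same as permuting the list of pairs, so the orbit of
  a pair of vectors is given by a multiset of pairs; the third component of the triple is a function
  of the other two and comes along.
\<close>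

lemma triple_orb_eq_mset_zip_class:
  assumes "length x = k" "length y = k"
  shows "triple_orb k (x, y, vadd N x y) =
    {(x', y', vadd N x' y') | x' y'. length x' = length y' \<and> mset (zip x' y') = mset (zip x y)}"
    (is "?L = ?R")
proof (intro equalityI subsetI)
  fix p assume "p \<in> ?L"
  then obtain \<sigma> where \<sigma>: "\<sigma> permutes {..<k}" and
    p: "p = (permute_list \<sigma> x, permute_list \<sigma> y, permute_list \<sigma> (vadd N x y))"
    by (auto simp: triple_orb_def)
  have zip: "zip (permute_list \<sigma> x) (permute_list \<sigma> y) = permute_list \<sigma> (zip x y)"
    using \<sigma> assms by (simp add: permute_list_zip[of \<sigma> "{..<k}"])
  have "permute_list \<sigma> (vadd N x y) = vadd N (permute_list \<sigma> x) (permute_list \<sigma> y)"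
    using \<sigma> assms by (simp add: vadd_conv_map_zip zip permute_list_map)
  moreover have "mset (zip (permute_list \<sigma> x) (permute_list \<sigma> y)) = mset (zip x y)"
    using \<sigma> assms by (simp add: zip)
  ultimately show "p \<in> ?R" using p assms by auto
next
  fix p assume "p \<in> ?R"
  then obtain x' y' where p: "p = (x', y', vadd N x' y')" and len: "length x' = length y'"
    and eq: "mset (zip x' y') = mset (zip x y)" by auto
  obtain \<sigma> where \<sigma>: "\<sigma> permutes {..<k}" "permute_list \<sigma> (zip x y) = zip x' y'"
    using mset_eq_permutation[OF eq] assms by auto
  have "zip (permute_list \<sigma> x) (permute_list \<sigma> y) = zip x' y'"
    using \<sigma> assms by (simp add: permute_list_zip[of \<sigma> "{..<k}"])
  moreover have "length x' = k"
    using len assms arg_cong[OF eq, of size] by simp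
  ultimately have xy: "x' = permute_list \<sigma> x" "y' = permute_list \<sigma> y"
    using len assms by (auto simp: zip_eq_conv)
  have "vadd N x' y' = permute_list \<sigma> (vadd N x y)"
    unfolding vadd_conv_map_zip \<sigma>(2)[symmetric]
    by (rule permute_list_map[symmetric]) (use \<sigma>(1) assms in simp)
  then show "p \<in> ?L"
    using \<sigma>(1) xy p by (auto simp: triple_orb_def)
qed

text \<open>
  A gluing is a coupling of \<open>X\<close> and \<open>Y\<close>, equivalently a matrix of natural numbers with
  prescribed row and column sums, subject to the further condition that \<open>f\<close> maps it to \<open>Z\<close>.
\<close>

definition gluings :: "('a \<Rightarrow> 'b \<Rightarrow> 'c) \<Rightarrow> 'a multiset \<Rightarrow> 'b multiset \<Rightarrow> 'c multiset \<Rightarrow> ('a \<times> 'b) multiset set"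
  where "gluings f X Y Z =
    {M. image_mset fst M = X \<and> image_mset snd M = Y \<and> image_mset (\<lambda>(u, v). f u v) M = Z}"

text \<open>
  Sending a multiset of pairs to the set of all triples that list it is a bijection from the gluings
  to the orbits of triples.
\<close>

lemma orbit_coeff_eq_card_gluings:
  assumes "length x = k" "length y = k" "length z = k"
  shows "orbit_coeff N k (orb k x) (orb k y) (orb k z) =
    card (gluings (add_mod N) (mset x) (mset y) (mset z))"
proof -
  define G where "G = gluings (add_mod N) (mset x) (mset y) (mset z)"
  define T where "T = triples N (orb k x) (orb k y) (orb k z)"
  define F where "F M = {(x', y', vadd N x' y') | x' y'. length x' = length y' \<and> mset (zip x' y') = M}"
    for M
  have F_eq: "F (mset (zip x' y')) = triple_orb k (x', y', vadd N x' y')"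
    if "length x' = k" "length y' = k" for x' y'
    using that by (simp add: F_def triple_orb_eq_mset_zip_class)
  have len: "length x' = k" "length y' = k" if "mset x' = mset x" "mset y' = mset y" for x' y'
    using that assms by (metis size_mset)+
  have "triple_orb k ` T \<subseteq> F ` G"
  proof
    fix p assume "p \<in> triple_orb k ` T"
    then obtain x' y' where p: "p = triple_orb k (x', y', vadd N x' y')"
      and eq: "mset x' = mset x" "mset y' = mset y" "mset (vadd N x' y') = mset z"
      using assms by (auto simp: T_def triples_def orb_eq_mset_class)
    have "p = F (mset (zip x' y'))" using p len eq F_eq by simp
    moreover have "mset (zip x' y') \<in> G"
      using eq len[OF eq(1,2)]
      by (simp add: G_def gluings_def vadd_conv_map_zip flip: mset_map)
    ultimately show "p \<in> F ` G" by blast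
  qed
  moreover have "F ` G \<subseteq> triple_orb k ` T"
  proof
    fix p assume "p \<in> F ` G"
    then obtain M where M: "M \<in> G" "p = F M" by blast
    obtain l where l: "mset l = M" using ex_mset by blast
    let ?x = "map fst l" and ?y = "map snd l"
    have zip: "zip ?x ?y = l" by (rule zip_map_fst_snd)
    have eq: "mset ?x = mset x" "mset ?y = mset y" "mset (vadd N ?x ?y) = mset z"
      using M l by (simp_all add: G_def gluings_def vadd_conv_map_zip zip)
    have "p = triple_orb k (?x, ?y, vadd N ?x ?y)"
      using F_eq[OF len[OF eq(1,2)]] M l zip by simp
    moreover have "(?x, ?y, vadd N ?x ?y) \<in> T"
      using eq assms by (simp add: T_def triples_def orb_eq_mset_class)
    ultimately show "p \<in> triple_orb k ` T" by blast
  qed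
  moreover have "inj_on F G"
  proof (rule inj_onI)
    fix M M' assume "F M = F M'"
    obtain l where l: "mset l = M" using ex_mset by blast
    have "(map fst l, map snd l, vadd N (map fst l) (map snd l)) \<in> F M"
      using l zip_map_fst_snd[of l] by (auto simp: F_def)
    then show "M = M'"
      using l zip_map_fst_snd[of l] unfolding \<open>F M = F M'\<close> by (auto simp: F_def)
  qed
  ultimately show ?thesis
    unfolding orbit_coeff_def T_def[symmetric] G_def[symmetric]
    by (metis card_image subset_antisym)
qed

section \<open>Products with the orbit of a constant vector\<close>

text \<open>
  Every entry on the left can only be paired with \<open>c\<close>, so at most one gluing exists.
\<close>

lemma gluings_const_right:
  "gluings f X (replicate_mset (size X) c) Z =
    (if Z = image_mset (\<lambda>u. f u c) X then {image_mset (\<lambda>u. (u, c)) X} else {})"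
proof -
  have M: "M = image_mset (\<lambda>u. (u, c)) X \<and> Z = image_mset (\<lambda>u. f u c) X"
    if "M \<in> gluings f X (replicate_mset (size X) c) Z" for M
  proof -
    have X: "image_mset fst M = X" and Y: "image_mset snd M = replicate_mset (size X) c"
      and Z: "image_mset (\<lambda>(u, v). f u v) M = Z"
      using that by (auto simp: gluings_def)
    have "snd p = c" if "p \<in># M" for p
      using that Y by (metis (no_types, lifting) image_eqI in_replicate_mset set_image_mset)
    then have M_eq: "M = image_mset (\<lambda>u. (u, c)) X"
      unfolding X[symmetric] image_mset.compositionality
      by (intro multiset.map_ident_strong[symmetric]) auto
    moreover have "Z = image_mset (\<lambda>u. f u c) X"
      using Z[symmetric] unfolding M_eq by (simp add: image_mset.compositionality comp_def)
    ultimately show ?thesis by blast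
  qed
  have in_gluings: "image_mset (\<lambda>u. (u, c)) X \<in> gluings f X (replicate_mset (size X) c) (image_mset (\<lambda>u. f u c) X)"
    by (simp add: gluings_def image_mset.compositionality comp_def image_mset_const_eq)
  show ?thesis
  proof (cases "Z = image_mset (\<lambda>u. f u c) X")
    case True
    have "gluings f X (replicate_mset (size X) c) Z = {image_mset (\<lambda>u. (u, c)) X}"
      using M in_gluings[folded True] by blast
    then show ?thesis unfolding if_P[OF True] .
  next
    case False
    have "gluings f X (replicate_mset (size X) c) Z = {}"
      using M False by blast
    then show ?thesis unfolding if_not_P[OF False] .
  qed
qed

text \<open>
  The orbit product is a sum over all orbits, and a sum over an infinite set would be zero.
\<close>

lemma finite_orbits: "finite (orbits N k)"
proof -
  have "zvecs N k = {x. set x \<subseteq> {0..int N - 1} \<and> length x = k}"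
    by (auto simp: zvecs_def residue_ring_def)
  then show ?thesis
    unfolding orbits_def by (simp add: finite_lists_length_eq)
qed

lemma orbit_prod_const_right:
  assumes "N \<ge> 1" "length x = k"
  shows "orbit_prod N k (frag_of (orb k x)) (frag_of (orb k (replicate k c))) =
    frag_of (orb k (map (\<lambda>u. add_mod N u c) x))"
proof -
  let ?s = "map (\<lambda>u. add_mod N u c) x"
  have s: "?s \<in> zvecs N k"
    using assms by (auto simp: zvecs_def residue_ring_def)
  have "orbit_coeff N k (orb k x) (orb k (replicate k c)) C = (if C = orb k ?s then 1 else 0)"
    if C: "C \<in> orbits N k" for C
  proof -
    obtain z where z: "C = orb k z" "length z = k"
      using C unfolding orbits_def zvecs_def by blast
    have "orbit_coeff N k (orb k x) (orb k (replicate k c)) C =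
        card (gluings (add_mod N) (mset x) (replicate_mset (size (mset x)) c) (mset z))"
      using assms z by (simp add: orbit_coeff_eq_card_gluings)
    also have "\<dots> = (if mset z = mset ?s then 1 else 0)"
      by (simp add: gluings_const_right del: size_mset)
    finally show ?thesis
      using z assms by (simp add: orb_eq_iff)
  qed
  then have "orbit_prod N k (frag_of (orb k x)) (frag_of (orb k (replicate k c))) =
      (\<Sum>C\<in>orbits N k. if C = orb k ?s then frag_of C else 0)"
    unfolding orbit_prod_def by (simp, intro sum.cong) auto
  also have "\<dots> = frag_of (orb k ?s)"
    using s finite_orbits by (simp add: orbits_def)
  finally show ?thesis .
qed

lemma orbit_power_const:
  assumes "N \<ge> 1"
  shows "orbit_power N k (frag_of (orb k (replicate k c))) t =
    frag_of (orb k (replicate k ((int t * c) mod int N)))"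
proof (induction t)
  case (Suc t)
  have "add_mod N ((int t * c) mod int N) c = (int (Suc t) * c) mod int N"
    by (simp add: mod_add_left_eq) (simp add: algebra_simps)
  then show ?case
    using assms Suc by (simp add: orbit_prod_const_right)
qed simp

section \<open>Gluing to a vector with two values\<close>

text \<open>
  A pair in such a gluing has first component \<open>p\<close> or \<open>q\<close>. The second components of the pairs
  \<open>(p, v)\<close> form a submultiset \<open>P\<close> of \<open>Y\<close>, and those of the pairs \<open>(q, v)\<close> are what is left.
\<close>

lemma card_gluings_two_values:
  assumes "p \<noteq> q" "m \<le> size Y"
  shows "card (gluings f (replicate_mset m p + replicate_mset (size Y - m) q) Y Z) =
    card {P. P \<subseteq># Y \<and> size P = m \<and> image_mset (f p) P + image_mset (f q) (Y - P) = Z}"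
    (is "card ?G = card ?S")
proof -
  define F where "F P = image_mset (Pair p) P + image_mset (Pair q) (Y - P)" for P
  define H where "H M = image_mset snd (filter_mset (\<lambda>r. fst r = p) M)" for M :: "('a \<times> 'b) multiset"
  have HF: "H (F P) = P" for P
    using assms(1)
    by (simp add: F_def H_def filter_mset_image_mset image_mset.compositionality comp_def)
  have F_sum: "image_mset (\<lambda>(u, v). f u v) (F P) = image_mset (f p) P + image_mset (f q) (Y - P)" for P
    by (simp add: F_def image_mset.compositionality comp_def)
  have F: "F P \<in> ?G" if "P \<in> ?S" for P
    using that by (auto simp: F_def gluings_def image_mset.compositionality comp_def
        image_mset_const_eq size_Diff_submset)
  have H: "H M \<in> ?S \<and> F (H M) = M" if "M \<in> ?G" for M
  proof -
    have X: "image_mset fst M = replicate_mset m p + replicate_mset (size Y - m) q"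
      and Y: "image_mset snd M = Y" and Z: "image_mset (\<lambda>(u, v). f u v) M = Z"
      using that by (auto simp: gluings_def)
    define M1 where "M1 = filter_mset (\<lambda>r. fst r = p) M"
    define M2 where "M2 = filter_mset (\<lambda>r. fst r \<noteq> p) M"
    have M: "M = M1 + M2" unfolding M1_def M2_def by (rule multiset_partition)
    have fst_M: "fst r = p \<or> fst r = q" if "r \<in># M" for r
    proof -
      have "fst r \<in># image_mset fst M" using that by simp
      then show ?thesis unfolding X by (auto split: if_splits)
    qed
    have M1: "M1 = image_mset (Pair p) (H M)"
      unfolding H_def M1_def[symmetric] image_mset.compositionality
      by (rule multiset.map_ident_strong[symmetric]) (auto simp: M1_def)
    have HY: "Y = H M + image_mset snd M2"
      unfolding Y[symmetric] H_def M1_def[symmetric] by (subst M) simp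
    then have YH: "Y - H M = image_mset snd M2" by simp
    have M2: "M2 = image_mset (Pair q) (Y - H M)"
      unfolding YH image_mset.compositionality
      by (rule multiset.map_ident_strong[symmetric]) (use fst_M in \<open>force simp: M2_def\<close>)
    have FH: "F (H M) = M" unfolding F_def using M M1 M2 by metis
    have "filter_mset (\<lambda>u. u = p) (image_mset fst M) = replicate_mset m p"
      unfolding X filter_eq_replicate_mset using assms(1) by simp
    then have "size (H M) = m"
      unfolding H_def filter_mset_image_mset
      by (metis (no_types, lifting) size_image_mset size_replicate_mset)
    moreover have "H M \<subseteq># Y" using HY by simp
    moreover have "image_mset (f p) (H M) + image_mset (f q) (Y - H M) = Z"
      using Z F_sum[of "H M"] unfolding FH by simp
    ultimately show ?thesis using FH by blast
  qed
  have "bij_betw F ?S ?G"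
    by (rule bij_betwI[of _ _ _ H]) (use F H HF in blast)+
  then show ?thesis by (simp add: bij_betw_same_card)
qed


section \<open>Raising some elements of a multiset of residues\<close>

text \<open>
  Equal successive differences make \<open>f - g\<close> constant, and equal sums make this constant zero.
\<close>

lemma int_eq_of_cyclic_differences_eq:
  fixes f g :: "nat \<Rightarrow> int"
  assumes diff: "\<And>i. Suc i < N \<Longrightarrow> f (Suc i) - f i = g (Suc i) - g i"
    and sum: "(\<Sum>i<N. f i) = (\<Sum>i<N. g i)" and "i < N"
  shows "f i = g i"
proof -
  have const: "f j - g j = f 0 - g 0" if "j < N" for j
    using that
  proof (induction j)
    case (Suc j)
    then show ?case using diff[of j] by simp
  qed simp
  have "0 = (\<Sum>j<N. f j - g j)"
    using sum by (simp add: sum_subtractf)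
  also have "\<dots> = int N * (f 0 - g 0)"
    using sum.cong[OF refl const, of "{..<N}"] by simp
  finally show ?thesis using const[of i] \<open>i < N\<close> by simp
qed

lemma bij_betw_shifted_residues:
  assumes "N \<ge> 1"
  shows "bij_betw (\<lambda>i. (int i - t) mod int N) {..<N} {0..<int N}"
proof (rule bij_betwI[of _ _ _ "\<lambda>u. nat ((u + t) mod int N)"])
  show "(\<lambda>i. (int i - t) mod int N) \<in> {..<N} \<rightarrow> {0..<int N}"
    using assms by auto
  show "(\<lambda>u. nat ((u + t) mod int N)) \<in> {0..<int N} \<rightarrow> {..<N}"
    using assms by (auto simp: nat_less_iff)
qed (use assms in \<open>auto simp: mod_simps\<close>)

text \<open>
  Adding \<open>s\<close> is injective on residues, so no multiplicities are merged.
\<close>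

lemma count_image_add_mod:
  assumes "set_mset P \<subseteq> {0..<int N}" "i < N"
  shows "count (image_mset (add_mod N s) P) (int i) = count P ((int i - s) mod int N)"
proof -
  have "add_mod N s -` {int i} \<inter> set_mset P = {(int i - s) mod int N} \<inter> set_mset P"
  proof -
    have "u = (int i - s) mod int N" if "u \<in># P" "add_mod N s u = int i" for u
    proof -
      have "(int i - s) mod int N = u mod int N"
        unfolding that(2)[symmetric] by (simp add: mod_diff_left_eq)
      then show ?thesis using that(1) assms(1) by auto
    qed
    moreover have "add_mod N s ((int i - s) mod int N) = int i"
      using assms(2) by (simp add: mod_add_right_eq)
    ultimately show ?thesis by auto
  qed
  then have "count (image_mset (add_mod N s) P) (int i) = (\<Sum>u\<in>{(int i - s) mod int N} \<inter> set_mset P. count P u)"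
    by (simp add: count_image_mset)
  then show ?thesis
    by (cases "(int i - s) mod int N \<in># P") (simp_all add: not_in_iff)
qed

text \<open>
  Here \<open>ms i\<close> is the number of elements of \<open>P\<close> that adding \<open>t\<close> takes to the residue \<open>i\<close>.
  These multiplicities determine \<open>P\<close>, and the multiplicity of \<open>i\<close> in the resulting multiset
  loses the \<open>ms i\<close> elements raised from \<open>i\<close> to \<open>i + 1\<close> and gains those raised from \<open>i - 1\<close>
  to \<open>i\<close>. Two solutions agree by the argument on cyclic differences.
\<close>

lemma card_raised_submultisets:
  fixes Y Z :: "int multiset"
  assumes "N \<ge> 1" and Y: "set_mset Y \<subseteq> {0..<int N}" and Z: "set_mset Z \<subseteq> {0..<int N}"
    and b: "\<And>i. i < N \<Longrightarrow> count Y ((int i - t) mod int N) = b i"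
    and c: "\<And>i. i < N \<Longrightarrow> count Z (int i) = c i"
  shows "card {P. P \<subseteq># Y \<and> size P = m \<and>
      image_mset (add_mod N ((1 + t) mod int N)) P + image_mset (add_mod N (t mod int N)) (Y - P) = Z} =
    (if \<exists>ms. (\<Sum>i<N. ms i) = m \<and> (\<forall>i<N. ms i \<le> b i) \<and>
        (\<forall>i<N. c i = b i - ms i + (if i = 0 then ms (N - 1) else ms (i - 1))) then 1 else 0)"
    (is "card ?S = (if \<exists>ms. ?Q ms then 1 else 0)")
proof -
  \<comment> \<open>\<open>r i\<close> is the residue that adding \<open>t\<close> takes to \<open>i\<close>, so along this enumeration the
    elements of \<open>Y\<close> and \<open>P\<close> are counted by their position after the shift.\<close>
  define r where "r i = (int i - t) mod int N" for i
  have bij: "bij_betw r {..<N} {0..<int N}"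
    unfolding r_def using \<open>N \<ge> 1\<close> by (rule bij_betw_shifted_residues)
  have r_ex: "\<exists>i<N. u = r i" if "0 \<le> u" "u < int N" for u
    using bij that unfolding bij_betw_def by (metis (no_types, lifting) atLeastLessThan_iff imageE lessThan_iff)
  have r_pred: "(int i - (1 + t)) mod int N = r (if i = 0 then N - 1 else i - 1)" if "i < N" for i
  proof (cases "i = 0")
    case True
    have "(int (N - 1) - t) mod int N = (int N + (- 1 - t)) mod int N"
      using \<open>N \<ge> 1\<close> by (simp add: of_nat_diff algebra_simps)
    then show ?thesis using True by (simp add: r_def)
  next
    case False
    then show ?thesis by (simp add: r_def of_nat_diff algebra_simps)
  qed
  have residues: "set_mset P \<subseteq> {0..<int N}" if "P \<subseteq># Y" for P
    using Y that by (meson set_mset_mono subset_trans)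
  have sum_r: "(\<Sum>i<N. count P (r i)) = size P" if "set_mset P \<subseteq> {0..<int N}" for P
  proof -
    have "(\<Sum>i<N. count P (r i)) = (\<Sum>u\<in>{0..<int N}. count P u)"
      by (rule sum.reindex_bij_betw[OF bij])
    also have "\<dots> = (\<Sum>u\<in>set_mset P. count P u)"
      using that by (intro sum.mono_neutral_right) (auto simp: not_in_iff)
    finally show ?thesis by (simp add: size_multiset_overloaded_eq)
  qed
  have multiset_eq: "P = P'"
    if "set_mset P \<subseteq> {0..<int N}" "set_mset P' \<subseteq> {0..<int N}" "\<And>i. i < N \<Longrightarrow> count P (r i) = count P' (r i)"
    for P P'
  proof (rule multiset_eqI)
    fix u
    show "count P u = count P' u"
    proof (cases "0 \<le> u \<and> u < int N")
      case True
      then show ?thesis using r_ex that(3) by blast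
    next
      case False
      then have "u \<notin># P" "u \<notin># P'" using that by auto
      then show ?thesis by (simp add: not_in_iff)
    qed
  qed
  have mem_iff: "P \<in> ?S \<longleftrightarrow> ?Q (\<lambda>i. count P (r i))" if P: "P \<subseteq># Y" for P
  proof -
    let ?W = "image_mset (add_mod N ((1 + t) mod int N)) P + image_mset (add_mod N (t mod int N)) (Y - P)"
    have W: "count ?W (int i) =
        b i - count P (r i) + count P (r (if i = 0 then N - 1 else i - 1))" if "i < N" for i
      using that residues[OF P] residues[of "Y - P"] b[OF that] r_pred[OF that]
      by (simp add: count_image_add_mod mod_diff_right_eq) (simp add: r_def)
    have "?W = Z \<longleftrightarrow> (\<forall>i<N. count ?W (int i) = count Z (int i))"
    proof
      assume eq: "\<forall>i<N. count ?W (int i) = count Z (int i)"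
      show "?W = Z"
      proof (rule multiset_eqI)
        fix u
        have W_residues: "set_mset ?W \<subseteq> {0..<int N}"
          using \<open>N \<ge> 1\<close> by auto
        show "count ?W u = count Z u"
        proof (cases "0 \<le> u \<and> u < int N")
          case True
          then show ?thesis using eq[rule_format, of "nat u"] by (simp add: nat_less_iff)
        next
          case False
          then have "u \<notin># ?W" "u \<notin># Z" using W_residues Z by auto
          then show ?thesis by (simp only: not_in_iff)
        qed
      qed
    qed simp
    also have "\<dots> \<longleftrightarrow> (\<forall>i<N. c i = b i - count P (r i) + count P (r (if i = 0 then N - 1 else i - 1)))"
      using W c by auto
    finally have W_eq: "?W = Z \<longleftrightarrow>
      (\<forall>i<N. c i = b i - count P (r i) + count P (r (if i = 0 then N - 1 else i - 1)))" .
    have "\<forall>i<N. count P (r i) \<le> b i"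
      using P b by (metis mset_subset_eq_count r_def)
    then show ?thesis
      using P W_eq sum_r[OF residues[OF P]] by (simp add: if_distrib[of r] if_distrib[of "count P"])
  qed
  show ?thesis
  proof (cases "\<exists>ms. ?Q ms")
    case True
    then obtain ms where ms: "?Q ms" by blast
    \<comment> \<open>The only multiset of residues with the multiplicities prescribed by \<open>ms\<close>.\<close>
    define P where "P = (\<Sum>i<N. replicate_mset (ms i) (r i))"
    have P_count: "count P (r i) = ms i" if "i < N" for i
    proof -
      have "r j = r i \<longleftrightarrow> j = i" "r i = r j \<longleftrightarrow> j = i" if "j < N" for j
        using bij \<open>i < N\<close> that by (auto simp: bij_betw_def inj_on_def)
      then have "count P (r i) = (\<Sum>j<N. if j = i then ms j else 0)"
        unfolding P_def count_sum by (intro sum.cong) simp_all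
      then show ?thesis using that by simp
    qed
    have P_residues: "set_mset P \<subseteq> {0..<int N}"
      using \<open>N \<ge> 1\<close> by (auto simp: P_def set_mset_sum r_def split: if_splits)
    have "P \<subseteq># Y"
    proof (rule mset_subset_eqI)
      fix u
      show "count P u \<le> count Y u"
      proof (cases "u \<in># P")
        case True
        then have "u \<in> {0..<int N}" using P_residues by blast
        then obtain i where "i < N" "u = r i"
          using r_ex[of u] by auto
        then show ?thesis using P_count ms b by (simp add: r_def)
      qed (simp add: not_in_iff)
    qed
    have "?Q (\<lambda>i. count P (r i))"
      using ms P_count \<open>N \<ge> 1\<close> by simp
    then have P_mem: "P \<in> ?S"
      using mem_iff[OF \<open>P \<subseteq># Y\<close>] by blast
    have "P' = P" if P': "P' \<in> ?S" for P'
    proof (rule multiset_eq[OF _ P_residues])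
      have sub: "P' \<subseteq># Y" using P' by blast
      show "set_mset P' \<subseteq> {0..<int N}" using residues[OF sub] .
      have q': "?Q (\<lambda>i. count P' (r i))" using mem_iff[OF sub] P' by blast
      have "int (count P' (r i)) = int (ms i)" if "i < N" for i
      proof (rule int_eq_of_cyclic_differences_eq[of N _ _ i])
        fix j assume j: "Suc j < N"
        have "c (Suc j) = b (Suc j) - count P' (r (Suc j)) + count P' (r j)"
          "count P' (r (Suc j)) \<le> b (Suc j)"
          using q' j by auto
        moreover have "c (Suc j) = b (Suc j) - ms (Suc j) + ms j" "ms (Suc j) \<le> b (Suc j)"
          using ms j by auto
        ultimately show "int (count P' (r (Suc j))) - int (count P' (r j)) = int (ms (Suc j)) - int (ms j)"
          by linarith
      next
        have "(\<Sum>i<N. count P' (r i)) = (\<Sum>i<N. ms i)"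
          using q' ms by simp
        then show "(\<Sum>i<N. int (count P' (r i))) = (\<Sum>i<N. int (ms i))"
          by (simp flip: of_nat_sum)
      qed (fact that)
      then show "count P' (r i) = count P (r i)" if "i < N" for i
        using P_count that by simp
    qed
    then have "?S = {P}" using P_mem by blast
    then show ?thesis unfolding if_P[OF True] by simp
  next
    case False
    have "?S = {}"
      using mem_iff False by blast
    then show ?thesis unfolding if_not_P[OF False] by (simp only: card.empty)
  qed
qed

section \<open>Standard forms of weights\<close>

lemma std_form_Suc: "std_form (Suc N) a = replicate (a N) (int N) @ std_form N a"
  by (simp add: std_form_def)

lemma count_std_form:
  "count (mset (std_form N a)) u = (if 0 \<le> u \<and> u < int N then a (nat u) else 0)"
proof (induction N)
  case 0
  then show ?case by (simp add: std_form_def)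
next
  case (Suc N)
  then show ?case by (auto simp: std_form_Suc)
qed

lemma length_std_form: "length (std_form N a) = (\<Sum>i<N. a i)"
  by (induction N) (simp_all add: std_form_Suc, simp add: std_form_def)

lemma set_std_form_subset: "set (std_form N a) \<subseteq> {0..<int N}"
  by (auto simp: std_form_def)

lemma std_form_eq_iff: "std_form N a = std_form N c \<longleftrightarrow> (\<forall>i<N. a i = c i)"
proof
  assume eq: "std_form N a = std_form N c"
  have "d i = count (mset (std_form N d)) (int i)" if "i < N" for d i
    using that by (simp add: count_std_form)
  then show "\<forall>i<N. a i = c i" using eq by metis
next
  assume "\<forall>i<N. a i = c i"
  then show "std_form N a = std_form N c"
    unfolding std_form_def by (intro arg_cong[of _ _ concat] map_cong) auto
qed

text \<open>
  The multiplicity of 0 is a truncated difference; the level condition is what keeps it exact, so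
  that the standard form has \<open>k\<close> entries.
\<close>

lemma length_weight_std:
  assumes "N \<ge> 1" "v \<in> level_weights N k"
  shows "length (weight_std N k v) = k"
proof -
  obtain a where v: "v = (\<lambda>i. \<Sum>j = 1..N - 1. a j * fund_weight j i)"
    and a: "(\<Sum>j = 1..N - 1. a j) \<le> k"
    using assms(2) by (auto simp: level_weights_def)
  have "v i = a i" if "i \<in> {1..N - 1}" for i
  proof -
    have "v i = (\<Sum>j = 1..N - 1. if j = i then a j else 0)"
      unfolding v by (intro sum.cong) (auto simp: fund_weight_def)
    then show ?thesis using that by simp
  qed
  then have le: "(\<Sum>j = 1..N - 1. v j) \<le> k" using a by simp
  have "{..<N} = insert 0 {1..N - 1}" using assms(1) by auto
  then show ?thesis
    using le by (simp add: weight_std_def length_std_form)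
qed

lemma mset_weight_std_mult_fund_weight_1:
  assumes "N \<ge> 2" "m \<le> k"
  shows "mset (weight_std N k (wmult m (fund_weight 1))) = replicate_mset m 1 + replicate_mset (k - m) 0"
proof (rule multiset_eqI)
  fix u
  have "(\<Sum>j = 1..N - 1. wmult m (fund_weight 1) j) = (\<Sum>j = 1..N - 1. if j = 1 then m else 0)"
    by (intro sum.cong) (auto simp: wmult_def fund_weight_def)
  also have "\<dots> = m" using assms(1) by simp
  finally have "(\<Sum>j = 1..N - 1. wmult m (fund_weight 1) j) = m" .
  moreover have "nat u = 1 \<longleftrightarrow> u = 1" by auto
  ultimately show "count (mset (weight_std N k (wmult m (fund_weight 1)))) u =
      count (replicate_mset m 1 + replicate_mset (k - m) 0) u"
    using assms by (auto simp: weight_std_def count_std_form wmult_def fund_weight_def)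
qed

section \<open>Structure constants for shifts of multiples of the first fundamental weight\<close>

theorem theorem5p1p8:
  fixes N k t m :: nat
    and lam mu nu :: weight
    and a b :: "nat \<Rightarrow> nat"
  assumes "N \<ge> 2" and "k \<ge> 1"
    and "mu \<in> level_weights N k" and "nu \<in> level_weights N k"
    and "t \<le> N - 1" and "m \<le> k"
    and "lam \<in> level_weights N k"
    and "orbit_prod N k
           (frag_of (weight_orbit N k (wmult m (fund_weight 1))))
           (orbit_power N k (frag_of (weight_orbit N k (wmult k (fund_weight 1)))) t)
         = frag_of (weight_orbit N k lam)"
    and "weight_std N k mu = std_form N a"
    and "\<And>i. i < N \<Longrightarrow> b i = (if t \<le> i then a (i - t) else a (N - (t - i)))"
  shows "orbit_coeff N k (weight_orbit N k lam) (weight_orbit N k mu) (weight_orbit N k nu) =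
    (if \<exists>ms :: nat \<Rightarrow> nat. (\<Sum>i<N. ms i) = m \<and> (\<forall>i<N. ms i \<le> b i) \<and>
          weight_std N k nu =
            std_form N (\<lambda>i. b i - ms i + (if i = 0 then ms (N - 1) else ms (i - 1)))
     then 1 else 0)"
proof -
  have N1: "N \<ge> 1" using assms(1) by simp
  define w where "w = weight_std N k (wmult m (fund_weight 1))"
  have w: "mset w = replicate_mset m 1 + replicate_mset (k - m) 0"
    unfolding w_def using assms(1,6) by (rule mset_weight_std_mult_fund_weight_1)
  have w_len: "length w = k"
    using arg_cong[OF w, of size] assms(6) by simp
  have u: "mset (weight_std N k (wmult k (fund_weight 1))) = mset (replicate k 1)"
    using mset_weight_std_mult_fund_weight_1[of N k k] assms(1) by simp
  then have "length (weight_std N k (wmult k (fund_weight 1))) = k"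
    by (metis length_replicate size_mset)
  then have "weight_orbit N k (wmult k (fund_weight 1)) = orb k (replicate k 1)"
    unfolding weight_orbit_def using u by (simp add: orb_eq_iff)
  then have power: "orbit_power N k (frag_of (weight_orbit N k (wmult k (fund_weight 1)))) t =
      frag_of (orb k (replicate k (int t mod int N)))"
    using orbit_power_const[OF N1, of k 1 t] by simp
  \<comment> \<open>A vector in the orbit of \<open>\<lambda>\<close>; its entries are \<open>t + 1\<close> and \<open>t\<close>, modulo \<open>N\<close>.\<close>
  define x where "x = map (\<lambda>u. add_mod N u (int t mod int N)) w"
  have lam: "weight_orbit N k lam = orb k x"
    using assms(8) orbit_prod_const_right[OF N1 w_len, of "int t mod int N"]
    unfolding power x_def by (simp add: weight_orbit_def w_def frag_of_eq)
  define Y where "Y = mset (weight_std N k mu)"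
  define Z where "Z = mset (weight_std N k nu)"
  define c where "c i = (if i = 0 then k - (\<Sum>j = 1..N - 1. nu j) else nu i)" for i
  have nu: "weight_std N k nu = std_form N c"
    unfolding weight_std_def c_def ..
  have size_Y: "size Y = k"
    using length_weight_std[OF N1 assms(3)] by (simp add: Y_def)
  have x: "mset x = replicate_mset m ((1 + int t) mod int N) + replicate_mset (size Y - m) (int t mod int N)"
    by (simp add: x_def w size_Y mod_simps)
  have "(1 + int t) mod int N \<noteq> int t mod int N"
  proof
    assume "(1 + int t) mod int N = int t mod int N"
    then have "int N dvd 1" by (simp add: mod_eq_dvd_iff)
    then show False using assms(1) by simp
  qed
  note two_values = card_gluings_two_values[OF this]
  have "orbit_coeff N k (weight_orbit N k lam) (weight_orbit N k mu) (weight_orbit N k nu) =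
      card (gluings (add_mod N) (mset x) Y Z)"
    unfolding lam weight_orbit_def[of N k mu] weight_orbit_def[of N k nu] Y_def Z_def
    by (rule orbit_coeff_eq_card_gluings)
      (use w_len length_weight_std[OF N1] assms(3,4) in \<open>simp_all add: x_def\<close>)
  also have "\<dots> = card {P. P \<subseteq># Y \<and> size P = m \<and>
      image_mset (add_mod N ((1 + int t) mod int N)) P +
      image_mset (add_mod N (int t mod int N)) (Y - P) = Z}"
    unfolding x by (rule two_values) (use size_Y assms(6) in simp)
  also have "\<dots> = (if \<exists>ms :: nat \<Rightarrow> nat. (\<Sum>i<N. ms i) = m \<and> (\<forall>i<N. ms i \<le> b i) \<and>
      (\<forall>i<N. c i = b i - ms i + (if i = 0 then ms (N - 1) else ms (i - 1))) then 1 else 0)"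
  proof (rule card_raised_submultisets[OF N1])
    show "set_mset Y \<subseteq> {0..<int N}" "set_mset Z \<subseteq> {0..<int N}"
      using set_std_form_subset by (simp_all add: Y_def Z_def assms(9) nu)
    show "count Z (int i) = c i" if "i < N" for i
      using that by (simp add: Z_def nu count_std_form)
    have Y_count: "count Y (int j) = a j" if "j < N" for j
      using that by (simp add: Y_def assms(9) count_std_form)
    show "count Y ((int i - int t) mod int N) = b i" if i: "i < N" for i
    proof (cases "t \<le> i")
      case True
      then have "(int i - int t) mod int N = int (i - t)"
        using i by (simp add: of_nat_diff)
      then show ?thesis
        using True i assms(10)[OF i] Y_count[of "i - t"] by (simp only:) simp
    next
      case False
      have "(int i - int t) mod int N = (int i - int t + int N) mod int N"
        by simp
      also have "\<dots> = int (N - (t - i))"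
        using False assms(1,5) i by (subst mod_pos_pos_trivial) (auto simp: of_nat_diff)
      finally show ?thesis
        using False i assms(10)[OF i] Y_count[of "N - (t - i)"] by (simp only:) simp
    qed
  qed
  finally show ?thesis
    unfolding nu std_form_eq_iff .
qed

end
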